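(* Let $(\Omega,\mathcal{E})$ be a measurable space and let $X$ be a countably $C$-separated $T_1$-space. (1) If $\{F_n\}$ is a countable family of closed-measurable compact-valued multifunctions $F_n:\Omega\to X$, then the multifunction $\omega\mapsto\bigcap_n F_n(\omega)$ is closed-measurable. (2) Let $S$ be a Souslin space and let $\{F_s\}_{s\in S}$ be a closed-measurable family of compact-valued multifunctions $F_s:\Omega\to X$. Then the multifunction $\omega\mapsto\bigcap_{s\in S}F_s(\omega)$ is universally closed-measurable.
   Context: A multifunction $F:\Omega\to X$ is a function assigning to each $\omega\in\Omega$ a (possibly empty) subset $F(\omega)\subset X$; it is compact-valued if every $F(\omega)$ is compact. A set is compact if every open cover of it has a finite subcover (no Hausdorff condition is included). For $A\subset X$ put $F^{-1}(A)=\{\omega : F(\omega)\cap A\neq\emptyset\}$. $F$ is closed-measurable (with respect to a $\sigma$-algebra on its domain) if $F^{-1}(C)$ is measurable for every closed $C\subset X$, and universally closed-measurable if $F^{-1}(C)$ is universally measurable for every closed $C\subset X$. Universally measurable sets: for a finite positive measure $\nu$ on $(\Omega,\mathcal{E})$, $\mathcal{E}_\nu$ is the family of sets $B\subset\Omega$ for which there are $A,C\in\mathcal{E}$ with $A\subset B\subset C$ and $\nu(C\setminus A)=0$. A set is universally measurable if it belongs to $\bigcap_\nu \mathcal{E}_\nu$, the intersection being over all finite positive measures $\nu$ on $\mathcal{E}$. A Souslin space is a metric space which is the image of a Polish space under a continuous map; it carries its Borel $\sigma$-algebra $\mathcal{B}(S)$. The family $\{F_s\}_{s\in S}$ is closed-measurable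 if the multifunction $(\omega,s)\mapsto F_s(\omega)$ from $\Omega\times S$ to $X$ is closed-measurable with respect to $\mathcal{E}\otimes\mathcal{B}(S)$. A family $\mathcal{U}$ of open subsets of $X$ is $C$-separating if for every compact set $K\subset X$ and every closed set $C\subset X$ disjoint from $K$ there is $U\in\mathcal{U}$ with $C\subset U$ and $U\cap K=\emptyset$. $X$ is countably $C$-separated if there exists a countable $C$-separating family of open sets. $X$ is $T_1$ if every finite subset of $X$ is closed. *)

theory Defs
  imports "HOL-Analysis.Analysis"
begin

definition C_separating :: "'x topology \<Rightarrow> 'x set set \<Rightarrow> bool" where
  "C_separating X \<U> \<longleftrightarrow>
     (\<forall>U\<in>\<U>. openin X U) \<and>
     (\<forall>K C. compactin X K \<and> closedin X C \<and> K \<inter> C = {} \<longrightarrow>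
        (\<exists>U\<in>\<U>. C \<subseteq> U \<and> U \<inter> K = {}))"

definition countably_C_separated :: "'x topology \<Rightarrow> bool" where
  "countably_C_separated X \<longleftrightarrow> (\<exists>\<U>. countable \<U> \<and> C_separating X \<U>)"

text \<open>A measurable space is given as a \<^typ>\<open>'w measure\<close>, of which only the carrier and the
  \<open>\<sigma>\<close>-algebra are used. A multifunction is a set-valued function whose values outside the
  carrier of its domain are irrelevant.\<close>

definition compact_valued :: "'w set \<Rightarrow> 'x topology \<Rightarrow> ('w \<Rightarrow> 'x set) \<Rightarrow> bool" where
  "compact_valued \<Omega> X F \<longleftrightarrow> (\<forall>\<omega>\<in>\<Omega>. compactin X (F \<omega>))"

definition multi_preimage :: "'w set \<Rightarrow> ('w \<Rightarrow> 'x set) \<Rightarrow> 'x set \<Rightarrow> 'w set" where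
  "multi_preimage \<Omega> F A = {\<omega>\<in>\<Omega>. F \<omega> \<inter> A \<noteq> {}}"

definition closed_measurable :: "'w measure \<Rightarrow> 'x topology \<Rightarrow> ('w \<Rightarrow> 'x set) \<Rightarrow> bool" where
  "closed_measurable M X F \<longleftrightarrow>
     (\<forall>C. closedin X C \<longrightarrow> multi_preimage (space M) F C \<in> sets M)"

definition measure_completion_sets :: "'w measure \<Rightarrow> 'w set set" where
  "measure_completion_sets N =
     {B. \<exists>A\<in>sets N. \<exists>C\<in>sets N. A \<subseteq> B \<and> B \<subseteq> C \<and> emeasure N (C - A) = 0}"

definition universally_measurable :: "'w measure \<Rightarrow> 'w set \<Rightarrow> bool" where
  "universally_measurable M B \<longleftrightarrow>
     (\<forall>N. finite_measure N \<and> sets N = sets M \<longrightarrow> B \<in> measure_completion_sets N)"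

definition universally_closed_measurable ::
    "'w measure \<Rightarrow> 'x topology \<Rightarrow> ('w \<Rightarrow> 'x set) \<Rightarrow> bool" where
  "universally_closed_measurable M X F \<longleftrightarrow>
     (\<forall>C. closedin X C \<longrightarrow> universally_measurable M (multi_preimage (space M) F C))"

definition Polish_space :: "'p topology \<Rightarrow> bool" where
  "Polish_space P \<longleftrightarrow> completely_metrizable_space P \<and> separable_space P"

text \<open>HOL cannot quantify existentially over types, so the type carrying the Polish space is a
  parameter. As a hypothesis of a theorem, with \<open>'p\<close> a free type variable, this says that \<open>S\<close> is
  the continuous image of some Polish space on some type.\<close>

definition Souslin_space :: "'p itself \<Rightarrow> 's metric \<Rightarrow> bool" where
  "Souslin_space _ S \<longleftrightarrow>
     (\<exists>(P :: 'p topology) f. Polish_space P \<and> continuous_map P (mtopology_of S) f \<and>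
        f ` topspace P = mspace S)"

definition Borel_of :: "'s topology \<Rightarrow> 's measure" where
  "Borel_of T = sigma (topspace T) {U. openin T U}"

definition closed_measurable_family ::
    "'w measure \<Rightarrow> 's metric \<Rightarrow> 'x topology \<Rightarrow> ('s \<Rightarrow> 'w \<Rightarrow> 'x set) \<Rightarrow> bool" where
  "closed_measurable_family M S X F \<longleftrightarrow>
     closed_measurable (M \<Otimes>\<^sub>M Borel_of (mtopology_of S)) X (\<lambda>(\<omega>, s). F s \<omega>)"

text \<open>Intersecting with the whole space fixes the value of an empty intersection as the whole
  space \<open>X\<close>, also when \<open>X\<close> does not exhaust its type.\<close>

definition multi_Inter :: "'x topology \<Rightarrow> 'i set \<Rightarrow> ('i \<Rightarrow> 'w \<Rightarrow> 'x set) \<Rightarrow> 'w \<Rightarrow> 'x set" where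
  "multi_Inter X I F = (\<lambda>\<omega>. topspace X \<inter> (\<Inter>i\<in>I. F i \<omega>))"

end

theory Submission
  imports Defs
begin

text \<open>A countable C-separating family \<open>\<U>\<close> makes every open set a countable union of closed
  sets, so closed-measurable multifunctions also have measurable preimages of open sets.
  If the \<open>F i \<omega>\<close> are compact, then \<open>\<Inter>i. F i \<omega>\<close> misses a closed set \<open>C\<close> if and only if there are
  finitely many \<open>U \<in> \<U>\<close>, each of them missed by some \<open>F i \<omega>\<close>, which together cover \<open>F i0 \<omega> \<inter> C\<close>,
  with \<open>i0\<close> a fixed index. So only the sets \<open>{\<omega>. \<exists>i. F i \<omega> \<inter> U = {}}\<close> with \<open>U \<in> \<U>\<close> have to be
  measurable. For a countable family they clearly are; for a family over a Souslin space they are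
  projections of measurable subsets of \<open>\<Omega> \<times> S\<close>, hence obtained by the Souslin operation from
  measurable sets, hence universally measurable.\<close>

subsection \<open>Intersections of compact-valued multifunctions\<close>

text \<open>Separating the compact set \<open>{x}\<close> from the closed complement of
  \<open>V\<close> puts \<open>x\<close> into one of these closed sets. With \<open>\<U>\<close>
  countable, every open set is thus a countable union of closed sets.\<close>

lemma C_separating_openin_eq:
  assumes sep: "C_separating X \<U>" and "t1_space X" and V: "openin X V"
  shows "V = \<Union> {topspace X - U |U. U \<in> \<U> \<and> topspace X - V \<subseteq> U}"
proof
  show "V \<subseteq> \<Union> {topspace X - U |U. U \<in> \<U> \<and> topspace X - V \<subseteq> U}"
  proof
    fix x assume x: "x \<in> V"
    then have "x \<in> topspace X" using V openin_subset by blast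
    then have "compactin X {x}" "closedin X (topspace X - V)" "{x} \<inter> (topspace X - V) = {}"
      using V x by auto
    then obtain U where "U \<in> \<U>" "topspace X - V \<subseteq> U" "U \<inter> {x} = {}"
      using sep unfolding C_separating_def by meson
    with \<open>x \<in> topspace X\<close> show "x \<in> \<Union> {topspace X - U |U. U \<in> \<U> \<and> topspace X - V \<subseteq> U}"
      by blast
  qed
  show "\<Union> {topspace X - U |U. U \<in> \<U> \<and> topspace X - V \<subseteq> U} \<subseteq> V"
    by blast
qed

lemma closed_measurable_open:
  assumes sep: "C_separating X \<U>" "countable \<U>" "t1_space X"
    and F: "closed_measurable M X F" and V: "openin X V"
  shows "multi_preimage (space M) F V \<in> sets M"
proof -
  define \<V> where "\<V> = {U \<in> \<U>. topspace X - V \<subseteq> U}"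
  have "countable \<V>"
    using sep(2) unfolding \<V>_def by (rule countable_subset[rotated]) auto
  have "V = (\<Union>U\<in>\<V>. topspace X - U)"
    using C_separating_openin_eq[OF sep(1,3) V] unfolding \<V>_def by blast
  then have "multi_preimage (space M) F V = (\<Union>U\<in>\<V>. multi_preimage (space M) F (topspace X - U))"
    unfolding multi_preimage_def by blast
  moreover have "multi_preimage (space M) F (topspace X - U) \<in> sets M" if "U \<in> \<V>" for U
  proof -
    have "openin X U" using that sep(1) unfolding \<V>_def C_separating_def by blast
    then have "closedin X (topspace X - U)" by blast
    then show ?thesis using F unfolding closed_measurable_def by blast
  qed
  ultimately show ?thesis
    using \<open>countable \<V>\<close> by auto
qed

text \<open>Compact sets need not be closed here, so the complements of the
  \<open>F i \<omega>\<close> cannot serve as an open cover. Members of \<open>\<U>\<close> replace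
  them: they cover the compact set \<open>C \<inter> F i0 \<omega>\<close>, and a finite subcover is
  the required \<open>\<V>\<close>.\<close>

lemma multi_Inter_disjoint_iff:
  assumes sep: "C_separating X \<U>" "t1_space X" and C: "closedin X C" and i0: "i0 \<in> I"
    and K: "\<And>i. i \<in> I \<Longrightarrow> compactin X (F i \<omega>)"
  shows "multi_Inter X I F \<omega> \<inter> C = {} \<longleftrightarrow>
    (\<exists>\<V>\<in>{\<V>. finite \<V> \<and> \<V> \<subseteq> \<U>}. F i0 \<omega> \<inter> (C - \<Union>\<V>) = {} \<and> (\<forall>U\<in>\<V>. \<exists>i\<in>I. F i \<omega> \<inter> U = {}))"
    (is "?L \<longleftrightarrow> ?R")
proof
  assume L: ?L
  define \<W> where "\<W> = {U \<in> \<U>. \<exists>i\<in>I. F i \<omega> \<inter> U = {}}"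
  have comp: "compactin X (C \<inter> F i0 \<omega>)"
    using closed_Int_compactin[OF C K[OF i0]] .
  have "C \<inter> F i0 \<omega> \<subseteq> \<Union>\<W>"
  proof
    fix x assume x: "x \<in> C \<inter> F i0 \<omega>"
    then have xX: "x \<in> topspace X" using C closedin_subset by blast
    then obtain i where i: "i \<in> I" "x \<notin> F i \<omega>"
      using L x unfolding multi_Inter_def by blast
    \<comment> \<open>The T1 axiom enters: in the separation property \<open>{x}\<close> now plays
      the closed set and \<open>F i \<omega>\<close> the compact one.\<close>
    have "closedin X {x}" using sep(2) xX by (simp add: t1_space_closedin_singleton)
    then obtain U where "U \<in> \<U>" "{x} \<subseteq> U" "U \<inter> F i \<omega> = {}"
      using sep(1) K[OF i(1)] i(2) unfolding C_separating_def
      by (metis Int_insert_right_if0 inf_bot_right)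
    with i(1) show "x \<in> \<Union>\<W>" unfolding \<W>_def by blast
  qed
  moreover have "\<And>U. U \<in> \<W> \<Longrightarrow> openin X U"
    using sep(1) unfolding \<W>_def C_separating_def by blast
  ultimately obtain \<V> where "finite \<V>" "\<V> \<subseteq> \<W>" "C \<inter> F i0 \<omega> \<subseteq> \<Union>\<V>"
    using compactinD[OF comp] by metis
  then show ?R unfolding \<W>_def by (intro bexI[of _ \<V>]) auto
next
  assume ?R
  then show ?L using i0 unfolding multi_Inter_def by blast
qed

text \<open>The empty intersection is constantly \<open>topspace X\<close>, so each preimage is
  empty or the whole space. The case is separate because no index \<open>i0\<close> is at hand to
  supply compactness.\<close>

lemma multi_Inter_empty_closed_measurable: "closed_measurable M X (multi_Inter X {} F)"
proof -
  have "{\<omega> \<in> space M. topspace X \<inter> C \<noteq> {}} \<in> sets M" for C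
    by (cases "topspace X \<inter> C = {}") auto
  then show ?thesis
    by (simp add: closed_measurable_def multi_preimage_def multi_Inter_def)
qed

text \<open>Common core of both claims; \<open>M\<close> will be the given measurable space or a
  completion of it. The finite subfamilies of the countable \<open>\<U>\<close> are countably many,
  so the disjointness criterion becomes a countable union.\<close>

lemma multi_Inter_closed_measurable:
  assumes sep: "C_separating X \<U>" "countable \<U>" "t1_space X" and i0: "i0 \<in> I"
    and K: "\<And>i. i \<in> I \<Longrightarrow> compact_valued (space M) X (F i)"
    and F: "closed_measurable M X (F i0)"
    and miss: "\<And>U. U \<in> \<U> \<Longrightarrow> {\<omega> \<in> space M. \<exists>i\<in>I. F i \<omega> \<inter> U = {}} \<in> sets M"
  shows "closed_measurable M X (multi_Inter X I F)"
  unfolding closed_measurable_def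
proof (intro allI impI)
  fix C assume C: "closedin X C"
  define E where "E U = {\<omega> \<in> space M. \<exists>i\<in>I. F i \<omega> \<inter> U = {}}" for U
  \<comment> \<open>The points where \<open>\<V>\<close> covers
    \<open>F i0 \<omega> \<inter> C\<close>; measurable because \<open>C - \<Union>\<V>\<close> is
    closed.\<close>
  define D where "D \<V> = space M - multi_preimage (space M) (F i0) (C - \<Union>\<V>)" for \<V>
  define \<F> where "\<F> = {\<V>. finite \<V> \<and> \<V> \<subseteq> \<U>}"
  have "countable \<F>"
    using countable_Collect_finite_subset[OF sep(2)] unfolding \<F>_def by simp
  have "multi_preimage (space M) (multi_Inter X I F) C
      = space M - (\<Union>\<V>\<in>\<F>. D \<V> \<inter> {\<omega> \<in> space M. \<forall>U\<in>\<V>. \<omega> \<in> E U})"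
  proof -
    have "\<omega> \<in> multi_preimage (space M) (multi_Inter X I F) C \<longleftrightarrow>
        \<not> (\<exists>\<V>\<in>\<F>. \<omega> \<in> D \<V> \<and> (\<forall>U\<in>\<V>. \<omega> \<in> E U))" if "\<omega> \<in> space M" for \<omega>
    proof -
      have K': "\<And>i. i \<in> I \<Longrightarrow> compactin X (F i \<omega>)"
        using K that unfolding compact_valued_def by blast
      have "multi_Inter X I F \<omega> \<inter> C = {} \<longleftrightarrow>
        (\<exists>\<V>\<in>\<F>. F i0 \<omega> \<inter> (C - \<Union>\<V>) = {} \<and> (\<forall>U\<in>\<V>. \<exists>i\<in>I. F i \<omega> \<inter> U = {}))"
        unfolding \<F>_def by (rule multi_Inter_disjoint_iff) (fact sep C i0 | erule K')+
      moreover have "\<And>U. \<omega> \<in> E U \<longleftrightarrow> (\<exists>i\<in>I. F i \<omega> \<inter> U = {})"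
        using that unfolding E_def by simp
      moreover have "\<And>\<V>. \<omega> \<in> D \<V> \<longleftrightarrow> F i0 \<omega> \<inter> (C - \<Union>\<V>) = {}"
        using that unfolding D_def multi_preimage_def by simp
      moreover have "\<omega> \<in> multi_preimage (space M) (multi_Inter X I F) C \<longleftrightarrow> multi_Inter X I F \<omega> \<inter> C \<noteq> {}"
        using that unfolding multi_preimage_def by simp
      ultimately show ?thesis by (simp only:)
    qed
    moreover have "multi_preimage (space M) (multi_Inter X I F) C \<subseteq> space M"
      unfolding multi_preimage_def by simp
    ultimately show ?thesis by (intro set_eqI) auto
  qed
  moreover have "D \<V> \<inter> {\<omega> \<in> space M. \<forall>U\<in>\<V>. \<omega> \<in> E U} \<in> sets M" if "\<V> \<in> \<F>" for \<V>
  proof -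
    have fin: "finite \<V>" and sub: "\<V> \<subseteq> \<U>" using that unfolding \<F>_def by auto
    have "openin X (\<Union>\<V>)"
      using sep(1) sub unfolding C_separating_def by blast
    then have "closedin X (C - \<Union>\<V>)" using C by (rule closedin_diff[rotated])
    then have "D \<V> \<in> sets M"
      using F unfolding D_def closed_measurable_def by blast
    moreover have "{\<omega> \<in> space M. \<forall>U\<in>\<V>. \<omega> \<in> E U} \<in> sets M"
    proof (rule sets.sets_Collect_finite_All[OF _ fin])
      fix U assume "U \<in> \<V>"
      then have "E U \<in> sets M" using miss sub unfolding E_def by blast
      moreover have "{\<omega> \<in> space M. \<omega> \<in> E U} = E U" unfolding E_def by auto
      ultimately show "{\<omega> \<in> space M. \<omega> \<in> E U} \<in> sets M" by simp
    qed
    ultimately show ?thesis by blast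
  qed
  ultimately show "multi_preimage (space M) (multi_Inter X I F) C \<in> sets M"
    using \<open>countable \<F>\<close> by (simp only:) (intro sets.compl_sets sets.countable_UN'; blast)
qed

subsection \<open>The Souslin operation\<close>

text \<open>Dependent choice builds sequences in which step \<open>n\<close> alters only entry
  \<open>n\<close>. Entry \<open>i\<close> is therefore final from stage \<open>Suc i\<close> on,
  and the diagonal agrees with stage \<open>n\<close> on the only entries that \<open>Q n\<close>
  looks at.\<close>

lemma prefix_choice:
  fixes Q :: "nat \<Rightarrow> (nat \<Rightarrow> 'a) \<Rightarrow> bool"
  assumes Q0: "Q 0 \<sigma>0"
    and step: "\<And>n \<sigma>. Q n \<sigma> \<Longrightarrow> \<exists>j. Q (Suc n) (\<sigma>(n := j))"
    and prefix: "\<And>n \<sigma> \<tau>. (\<And>i. i < n \<Longrightarrow> \<sigma> i = \<tau> i) \<Longrightarrow> Q n \<sigma> \<Longrightarrow> Q n \<tau>"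
  shows "\<exists>\<sigma>. \<forall>n. Q n \<sigma>"
proof -
  have "\<exists>f. \<forall>n. Q n (f n) \<and> (\<exists>j. f (Suc n) = (f n)(n := j))"
    by (rule dependent_nat_choice) (use Q0 step in blast)+
  then obtain f where f: "\<And>n. Q n (f n)" and upd: "\<And>n. \<exists>j. f (Suc n) = (f n)(n := j)"
    by blast
  have stable: "f (Suc i + k) i = f (Suc i) i" for i k
  proof (induction k)
    case (Suc k)
    obtain j where "f (Suc (Suc i + k)) = (f (Suc i + k))(Suc i + k := j)" using upd by blast
    then show ?case using Suc by simp
  qed simp
  have diag: "f n i = f (Suc i) i" if "i < n" for i n
    using stable[of i "n - Suc i"] that by simp
  have "Q n (\<lambda>i. f (Suc i) i)" for n
    by (rule prefix[of n "f n"], erule diag, rule f)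
  then show ?thesis by blast
qed

text \<open>Koenig's lemma for the finitely branching tree of sequences bounded by
  \<open>K\<close>.\<close>

lemma koenig_bounded:
  fixes K :: "nat \<Rightarrow> nat"
  assumes prefix: "\<And>n \<sigma> \<tau>. (\<And>i. i < n \<Longrightarrow> \<sigma> i = \<tau> i) \<Longrightarrow> P n \<sigma> \<Longrightarrow> P n \<tau>"
    and ex: "\<And>n. \<exists>\<sigma>. (\<forall>i<n. \<sigma> i \<le> K i) \<and> (\<forall>m\<le>n. P m \<sigma>)"
  shows "\<exists>\<sigma>. \<forall>n. P n \<sigma>"
proof -
  \<comment> \<open>The Koenig invariant: the first \<open>n\<close> entries of
    \<open>\<sigma>\<close> extend to good bounded sequences of every depth
    \<open>m\<close>.\<close>
  define Q where "Q n \<sigma> \<longleftrightarrow>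
    (\<forall>m. \<exists>\<tau>. (\<forall>i<n. \<tau> i = \<sigma> i) \<and> (\<forall>i<m. \<tau> i \<le> K i) \<and> (\<forall>l\<le>m. P l \<tau>))" for n \<sigma>
  have "\<exists>\<sigma>. \<forall>n. Q n \<sigma>"
  proof (rule prefix_choice)
    show "Q 0 (\<lambda>_. 0)" using ex unfolding Q_def by simp
  next
    fix n \<sigma> assume Q: "Q n \<sigma>"
    show "\<exists>j. Q (Suc n) (\<sigma>(n := j))"
    proof (rule ccontr)
      assume "\<nexists>j. Q (Suc n) (\<sigma>(n := j))"
      then obtain b where b: "\<And>j \<tau>. \<lbrakk>\<forall>i<Suc n. \<tau> i = (\<sigma>(n := j)) i; \<forall>i<b j. \<tau> i \<le> K i\<rbrakk>
          \<Longrightarrow> \<exists>l\<le>b j. \<not> P l \<tau>"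
        unfolding Q_def by metis
      \<comment> \<open>\<open>b j\<close> is a depth at which continuing with \<open>j\<close>
        fails. Beyond the largest of these no candidate survives, and \<open>Suc n\<close> ensures
        that \<open>\<tau> n\<close> obeys the bound and so is among the finitely many
        candidates.\<close>
      define m where "m = max (Suc n) (Max (b ` {..K n}))"
      obtain \<tau> where \<tau>: "\<forall>i<n. \<tau> i = \<sigma> i" "\<forall>i<m. \<tau> i \<le> K i" "\<forall>l\<le>m. P l \<tau>"
        using Q unfolding Q_def by blast
      have "\<tau> n \<le> K n" using \<tau>(2) unfolding m_def by simp
      then have "b (\<tau> n) \<le> Max (b ` {..K n})" by (intro Max_ge) auto
      then have bm: "b (\<tau> n) \<le> m" unfolding m_def by simp
      have "\<forall>i<Suc n. \<tau> i = (\<sigma>(n := \<tau> n)) i" using \<tau>(1) by (simp add: less_Suc_eq)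
      moreover have "\<forall>i<b (\<tau> n). \<tau> i \<le> K i" using \<tau>(2) bm by auto
      ultimately obtain l where "l \<le> b (\<tau> n)" "\<not> P l \<tau>" using b by blast
      with \<tau>(3) bm show False by auto
    qed
  next
    fix n and \<sigma> \<tau> :: "nat \<Rightarrow> nat"
    assume "\<And>i. i < n \<Longrightarrow> \<sigma> i = \<tau> i" "Q n \<sigma>"
    then show "Q n \<tau>" unfolding Q_def by simp
  qed
  then obtain \<sigma> where \<sigma>: "\<And>n. Q n \<sigma>" by blast
  have "P n \<sigma>" for n
  proof -
    obtain \<tau> where "\<forall>i<n. \<tau> i = \<sigma> i" "\<forall>l\<le>n. P l \<tau>" using \<sigma>[of n] unfolding Q_def by blast
    then show ?thesis using prefix[of n \<tau> \<sigma>] by blast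
  qed
  then show ?thesis by blast
qed

text \<open>A scheme indexed by finite sequences, encoded as a function of an infinite sequence and
  a length \<open>n\<close> that reads only the first \<open>n\<close> entries. The sets built from
  it are the results of the Souslin operation.\<close>

definition souslin_scheme :: "'a set set \<Rightarrow> ((nat \<Rightarrow> nat) \<Rightarrow> nat \<Rightarrow> 'a set) \<Rightarrow> bool" where
  "souslin_scheme \<G> R \<longleftrightarrow>
     (\<forall>\<sigma> n. R \<sigma> n \<in> \<G>) \<and> (\<forall>\<sigma> \<tau> n. (\<forall>i<n. \<sigma> i = \<tau> i) \<longrightarrow> R \<sigma> n = R \<tau> n)"

definition souslin_sets :: "'a set set \<Rightarrow> 'a set set" where
  "souslin_sets \<G> = {\<Union>\<sigma>. \<Inter>n. R \<sigma> n | R. souslin_scheme \<G> R}"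

lemma souslin_scheme_sets: "souslin_scheme \<G> R \<Longrightarrow> R \<sigma> n \<in> \<G>"
  by (simp add: souslin_scheme_def)

lemma souslin_scheme_prefix:
  "souslin_scheme \<G> R \<Longrightarrow> (\<And>i. i < n \<Longrightarrow> \<sigma> i = \<tau> i) \<Longrightarrow> R \<sigma> n = R \<tau> n"
  by (simp add: souslin_scheme_def)

lemma souslin_setsI:
  fixes R :: "(nat \<Rightarrow> nat) \<Rightarrow> nat \<Rightarrow> 'a set"
  assumes "\<And>\<sigma> n. R \<sigma> n \<in> \<G>"
    and "\<And>\<sigma> \<tau> n. (\<And>i. i < n \<Longrightarrow> \<sigma> i = \<tau> i) \<Longrightarrow> R \<sigma> n = R \<tau> n"
    and "A = (\<Union>\<sigma>. \<Inter>n. R \<sigma> n)"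
  shows "A \<in> souslin_sets \<G>"
proof -
  have "souslin_scheme \<G> R"
    unfolding souslin_scheme_def
  proof (intro conjI allI impI)
    show "R \<sigma> n \<in> \<G>" for \<sigma> n by (rule assms(1))
    show "R \<sigma> n = R \<tau> n" if "\<forall>i<n. \<sigma> i = \<tau> i" for \<sigma> \<tau> n
      using that by (intro assms(2)) simp
  qed
  then show ?thesis unfolding souslin_sets_def assms(3) by blast
qed

lemma souslin_setsE:
  assumes "A \<in> souslin_sets \<G>"
  obtains R where "souslin_scheme \<G> R" "A = (\<Union>\<sigma>. \<Inter>n. R \<sigma> n)"
  using assms unfolding souslin_sets_def by blast

lemma souslin_sets_schemesE:
  assumes "\<And>m. A m \<in> souslin_sets \<G>"
  obtains R where "\<And>m. souslin_scheme \<G> (R m)" "\<And>m. A m = (\<Union>\<sigma>. \<Inter>n. R m \<sigma> n)"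
proof -
  have "\<exists>R. souslin_scheme \<G> R \<and> A m = (\<Union>\<sigma>. \<Inter>n. R \<sigma> n)" for m
    using assms[of m] by (auto elim: souslin_setsE)
  then show thesis using that by metis
qed

lemma souslin_sets_base: "G \<in> \<G> \<Longrightarrow> G \<in> souslin_sets \<G>"
  by (rule souslin_setsI[of "\<lambda>_ _. G"]) auto

text \<open>Pairing lets one branch code a branch for every \<open>m\<close>; level
  \<open>prod_encode (m, n)\<close> of the new scheme is level \<open>n\<close> of the scheme for
  \<open>A m\<close>.\<close>

lemma souslin_sets_INT:
  assumes "\<And>m::nat. A m \<in> souslin_sets \<G>"
  shows "(\<Inter>m. A m) \<in> souslin_sets \<G>"
proof -
  from assms(1) obtain R where sch: "\<And>m. souslin_scheme \<G> (R m)"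
    and A: "\<And>m. A m = (\<Union>\<sigma>. \<Inter>n. R m \<sigma> n)"
    by (rule souslin_sets_schemesE) (rule that)
  note R = souslin_scheme_sets[OF sch] and dep = souslin_scheme_prefix[OF sch]
  define R' where "R' \<sigma> k = (case prod_decode k of (m, n) \<Rightarrow> R m (\<lambda>i. \<sigma> (prod_encode (m, i))) n)"
    for \<sigma> k
  have R'_encode: "R' \<sigma> (prod_encode (m, n)) = R m (\<lambda>i. \<sigma> (prod_encode (m, i))) n" for \<sigma> m n
    unfolding R'_def by simp
  show ?thesis
  proof (rule souslin_setsI[of R'])
    show "R' \<sigma> k \<in> \<G>" for \<sigma> k
      unfolding R'_def using R by (simp split: prod.split)
  next
    fix \<sigma> \<tau> :: "nat \<Rightarrow> nat" and k assume eq: "\<And>i. i < k \<Longrightarrow> \<sigma> i = \<tau> i"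
    obtain m n where k: "k = prod_encode (m, n)"
      by (metis prod_decode_inverse surj_pair)
    \<comment> \<open>Monotonicity of the pairing in its second argument guarantees that level
      \<open>k\<close> reads only entries below \<open>k\<close>.\<close>
    have mono: "prod_encode (m, i) < prod_encode (m, n)" if "i < n" for i
      using that
    proof (induction n)
      case (Suc n)
      have "prod_encode (m, n) < prod_encode (m, Suc n)" by (simp add: prod_encode_def)
      then show ?case using Suc by (cases "i = n") auto
    qed simp
    show "R' \<sigma> k = R' \<tau> k"
      unfolding k R'_encode by (rule dep, rule eq) (simp add: k mono)
  next
    show "(\<Inter>m. A m) = (\<Union>\<sigma>. \<Inter>k. R' \<sigma> k)"
    proof (intro equalityI subsetI)
      fix x assume "x \<in> (\<Inter>m. A m)"
      then have "\<forall>m. \<exists>\<sigma>. \<forall>n. x \<in> R m \<sigma> n" by (simp add: A)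
      then obtain s where s: "\<And>m n. x \<in> R m (s m) n" by metis
      define \<sigma> where "\<sigma> k = (case prod_decode k of (m, i) \<Rightarrow> s m i)" for k
      have "(\<lambda>i. \<sigma> (prod_encode (m, i))) = s m" for m unfolding \<sigma>_def by simp
      then have "x \<in> R' \<sigma> k" for k
        unfolding R'_def using s by (simp split: prod.split)
      then show "x \<in> (\<Union>\<sigma>. \<Inter>k. R' \<sigma> k)" by blast
    next
      fix x assume "x \<in> (\<Union>\<sigma>. \<Inter>k. R' \<sigma> k)"
      then obtain \<sigma> where "\<And>k. x \<in> R' \<sigma> k" by blast
      then have "x \<in> R m (\<lambda>i. \<sigma> (prod_encode (m, i))) n" for m n
        using R'_encode by metis
      then show "x \<in> (\<Inter>m. A m)" by (auto simp: A)
    qed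
  qed
qed

text \<open>The first entry of a branch selects \<open>m\<close>, the remaining ones form a branch
  of the scheme for \<open>A m\<close>.\<close>

lemma souslin_sets_UN:
  assumes "\<And>m::nat. A m \<in> souslin_sets \<G>" and T: "T \<in> \<G>" "\<And>G. G \<in> \<G> \<Longrightarrow> G \<subseteq> T"
  shows "(\<Union>m. A m) \<in> souslin_sets \<G>"
proof -
  from assms(1) obtain R where sch: "\<And>m. souslin_scheme \<G> (R m)"
    and A: "\<And>m. A m = (\<Union>\<sigma>. \<Inter>n. R m \<sigma> n)"
    by (rule souslin_sets_schemesE) (rule that)
  note R = souslin_scheme_sets[OF sch] and dep = souslin_scheme_prefix[OF sch]
  \<comment> \<open>Level 0 may not read \<open>\<sigma>\<close>, so it holds the largest set
    \<open>T\<close>, which does not change the intersection.\<close>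
  define R' where "R' \<sigma> k = (case k of 0 \<Rightarrow> T | Suc n \<Rightarrow> R (\<sigma> 0) (\<lambda>i. \<sigma> (Suc i)) n)" for \<sigma> k
  show ?thesis
  proof (rule souslin_setsI[of R'])
    show "R' \<sigma> k \<in> \<G>" for \<sigma> k
      unfolding R'_def using R T by (simp split: nat.split)
  next
    fix \<sigma> \<tau> :: "nat \<Rightarrow> nat" and k assume eq: "\<And>i. i < k \<Longrightarrow> \<sigma> i = \<tau> i"
    show "R' \<sigma> k = R' \<tau> k"
    proof (cases k)
      case (Suc n)
      then have "R (\<sigma> 0) (\<lambda>i. \<sigma> (Suc i)) n = R (\<sigma> 0) (\<lambda>i. \<tau> (Suc i)) n"
        using eq by (intro dep) auto
      then show ?thesis using eq[of 0] Suc unfolding R'_def by simp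
    qed (simp add: R'_def)
  next
    show "(\<Union>m. A m) = (\<Union>\<sigma>. \<Inter>k. R' \<sigma> k)"
    proof (intro equalityI subsetI)
      fix x assume "x \<in> (\<Union>m. A m)"
      then obtain m \<sigma> where \<sigma>: "\<And>n. x \<in> R m \<sigma> n" unfolding A by blast
      then have "x \<in> T" using T R by blast
      then have "x \<in> R' (case_nat m \<sigma>) k" for k
        using \<sigma> unfolding R'_def by (cases k) auto
      then show "x \<in> (\<Union>\<sigma>. \<Inter>k. R' \<sigma> k)" by blast
    next
      fix x assume "x \<in> (\<Union>\<sigma>. \<Inter>k. R' \<sigma> k)"
      then obtain \<sigma> where "\<And>k. x \<in> R' \<sigma> k" by blast
      from this[of "Suc _"] have "x \<in> R (\<sigma> 0) (\<lambda>i. \<sigma> (Suc i)) n" for n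
        unfolding R'_def by simp
      then show "x \<in> (\<Union>m. A m)" unfolding A by blast
    qed
  qed
qed

subsection \<open>Universal measurability of Souslin sets\<close>

text \<open>The sandwich condition is thereby seen to define a \<sigma>-algebra, so the core lemma
  can be applied to the completion as a measurable space.\<close>

lemma measure_completion_sets_eq:
  "measure_completion_sets N = sets (completion N)"
proof (intro equalityI subsetI)
  fix B assume "B \<in> measure_completion_sets N"
  then obtain A C where AC: "A \<in> sets N" "C \<in> sets N" "A \<subseteq> B" "B \<subseteq> C" "emeasure N (C - A) = 0"
    unfolding measure_completion_sets_def by blast
  show "B \<in> sets (completion N)"
    by (rule sets_completionI[of _ A "B - A" "C - A"]) (use AC in auto)
next
  fix B assume "B \<in> sets (completion N)"
  then obtain S Z Z' where B: "B = S \<union> Z" "Z \<subseteq> Z'" "Z' \<in> null_sets N" "S \<in> sets N"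
    by (rule sets_completionE)
  have "emeasure N (S \<union> Z' - S) = 0"
  proof -
    have "emeasure N (S \<union> Z' - S) \<le> emeasure N Z'" using B by (intro emeasure_mono) auto
    then show ?thesis using B by auto
  qed
  then show "B \<in> measure_completion_sets N"
    unfolding measure_completion_sets_def using B
    by (intro CollectI bexI[of _ S] bexI[of _ "S \<union> Z'"]) auto
qed

text \<open>The union over uncountably many branches is really finite: up to level \<open>n\<close>
  only the first \<open>n\<close> entries matter, and these are bounded.\<close>

lemma souslin_scheme_bounded_sets:
  assumes sch: "souslin_scheme (sets N) R"
  shows "(\<Union>\<sigma>\<in>{\<sigma>. \<forall>i<n. \<sigma> i \<le> K i}. \<Inter>m\<in>{..n}. R \<sigma> m) \<in> sets N"
proof -
  let ?T = "\<lambda>\<sigma>. \<Inter>m\<in>{..n}. R \<sigma> m"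
  let ?S = "{\<sigma>. \<forall>i<n. \<sigma> i \<le> K i}"
  have "?T \<sigma> \<in> ?T ` (PiE {..<n} (\<lambda>i. {..K i}))" if "\<sigma> \<in> ?S" for \<sigma>
  proof (rule image_eqI)
    show "?T \<sigma> = ?T (restrict \<sigma> {..<n})"
      using souslin_scheme_prefix[OF sch, of _ \<sigma> "restrict \<sigma> {..<n}"] by simp
    show "restrict \<sigma> {..<n} \<in> PiE {..<n} (\<lambda>i. {..K i})" using that by auto
  qed
  then have "?T ` ?S \<subseteq> ?T ` (PiE {..<n} (\<lambda>i. {..K i}))" by blast
  then have "finite (?T ` ?S)"
    by (rule finite_subset) (intro finite_imageI finite_PiE; simp)
  moreover have "?T \<sigma> \<in> sets N" for \<sigma>
    using souslin_scheme_sets[OF sch] by (intro sets.finite_INT) auto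
  ultimately show ?thesis by (intro sets.finite_Union) auto
qed

text \<open>As in Choquet's capacitability theorem: the entries of the branches can be bounded one after
  the other at an arbitrarily small cost in outer measure, and the bounded branches form a compact
  set, on which union and intersection commute.\<close>

lemma souslin_inner_approx:
  fixes \<epsilon> :: real
  assumes "finite_measure N" and sch: "souslin_scheme (sets N) R" and "0 < \<epsilon>"
  defines "B \<equiv> \<Union>\<sigma>. \<Inter>n. R \<sigma> n"
  shows "\<exists>A\<in>sets N. A \<subseteq> B \<and> outer_measure_of N B \<le> emeasure N A + ennreal \<epsilon>"
proof -
  interpret finite_measure N by fact
  define c where "c = outer_measure_of N B"
  \<comment> \<open>\<open>B'\<close> keeps full branches whose first \<open>n\<close> entries are
    bounded, \<open>C\<close> cuts them off at level \<open>n\<close>. For the bound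
    \<open>K\<close> found below, \<open>B'\<close> has large outer measure, while the larger set
    \<open>C\<close> is measurable.\<close>
  define B' where "B' n k = (\<Union>\<sigma>\<in>{\<sigma>. \<forall>i<n. \<sigma> i \<le> k i}. \<Inter>m. R \<sigma> m)" for n and k :: "nat \<Rightarrow> nat"
  define C where "C n k = (\<Union>\<sigma>\<in>{\<sigma>. \<forall>i<n. \<sigma> i \<le> k i}. \<Inter>m\<in>{..n}. R \<sigma> m)" for n and k :: "nat \<Rightarrow> nat"
  have space: "R \<sigma> n \<subseteq> space N" for \<sigma> n
    using souslin_scheme_sets[OF sch] sets.sets_into_space by blast
  have B'_space: "B' n k \<subseteq> space N" for n k
    unfolding B'_def using space by blast
  have "B \<subseteq> space N" unfolding B_def using space by blast
  then have "c \<le> emeasure N (space N)"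
    unfolding c_def by (rule outer_measure_of_mono[THEN order_trans]) simp
  then have c_fin: "c < top"
    using emeasure_finite[of "space N"] by (metis infinity_ennreal_def top.not_eq_extremum top.extremum_uniqueI)
  \<comment> \<open>A strict inequality passes from a supremum to one of its terms, so the same
    \<open>\<epsilon>\<close> serves at every stage.\<close>
  have "\<exists>k. \<forall>n. c < outer_measure_of N (B' n k) + ennreal \<epsilon>"
  proof (rule prefix_choice)
    have "B' 0 (\<lambda>_. 0) = B" unfolding B'_def B_def by simp
    then show "c < outer_measure_of N (B' 0 (\<lambda>_. 0)) + ennreal \<epsilon>"
      using c_fin \<open>0 < \<epsilon>\<close> ennreal_add_left_cancel_less[of c 0 "ennreal \<epsilon>"] unfolding c_def by auto
  next
    fix n k assume c: "c < outer_measure_of N (B' n k) + ennreal \<epsilon>"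
    have "B' n k = (\<Union>j. B' (Suc n) (k(n := j)))"
    proof (intro equalityI subsetI)
      fix x assume "x \<in> B' n k"
      then obtain \<sigma> where \<sigma>: "\<forall>i<n. \<sigma> i \<le> k i" "x \<in> (\<Inter>m. R \<sigma> m)" unfolding B'_def by blast
      then have "\<forall>i<Suc n. \<sigma> i \<le> (k(n := \<sigma> n)) i" by (simp add: less_Suc_eq)
      with \<sigma>(2) show "x \<in> (\<Union>j. B' (Suc n) (k(n := j)))" unfolding B'_def by blast
    next
      fix x assume "x \<in> (\<Union>j. B' (Suc n) (k(n := j)))"
      then obtain j \<sigma> where \<sigma>: "\<forall>i<Suc n. \<sigma> i \<le> (k(n := j)) i" "x \<in> (\<Inter>m. R \<sigma> m)"
        unfolding B'_def by blast
      then have "\<forall>i<n. \<sigma> i \<le> k i" by (metis fun_upd_other less_Suc_eq less_irrefl)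
      with \<sigma>(2) show "x \<in> B' n k" unfolding B'_def by blast
    qed
    moreover have "incseq (\<lambda>j. B' (Suc n) (k(n := j)))"
    proof (rule incseq_SucI)
      fix j
      have "\<forall>i<Suc n. \<sigma> i \<le> (k(n := Suc j)) i" if "\<forall>i<Suc n. \<sigma> i \<le> (k(n := j)) i" for \<sigma> :: "nat \<Rightarrow> nat"
        using that by (auto simp: le_Suc_eq)
      then show "B' (Suc n) (k(n := j)) \<subseteq> B' (Suc n) (k(n := Suc j))"
        unfolding B'_def by blast
    qed
    \<comment> \<open>Outer measure is continuous along increasing sequences even of nonmeasurable
      sets.\<close>
    ultimately have "outer_measure_of N (B' n k) = (SUP j. outer_measure_of N (B' (Suc n) (k(n := j))))"
      using SUP_outer_measure_of_incseq[of "\<lambda>j. B' (Suc n) (k(n := j))" N] B'_space by simp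
    then have "c < (SUP j. outer_measure_of N (B' (Suc n) (k(n := j))) + ennreal \<epsilon>)"
      using c by (simp add: ennreal_SUP_add_left)
    then show "\<exists>j. c < outer_measure_of N (B' (Suc n) (k(n := j))) + ennreal \<epsilon>"
      by (simp add: less_SUP_iff)
  next
    fix n and k k' :: "nat \<Rightarrow> nat"
    assume eq: "\<And>i. i < n \<Longrightarrow> k i = k' i" and "c < outer_measure_of N (B' n k) + ennreal \<epsilon>"
    moreover have "B' n k = B' n k'" using eq unfolding B'_def by simp
    ultimately show "c < outer_measure_of N (B' n k') + ennreal \<epsilon>" by simp
  qed
  then obtain K where K: "\<And>n. c < outer_measure_of N (B' n K) + ennreal \<epsilon>" by blast
  have C_sets: "C n K \<in> sets N" for n
    unfolding C_def by (rule souslin_scheme_bounded_sets[OF sch])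
  have "decseq (\<lambda>n. C n K)"
  proof (rule decseq_SucI)
    show "C (Suc n) K \<subseteq> C n K" for n
      unfolding C_def by (intro UN_mono INT_anti_mono) auto
  qed
  then have INF: "(INF n. emeasure N (C n K)) = emeasure N (\<Inter>n. C n K)"
    using C_sets by (intro INF_emeasure_decseq) auto
  have "B' n K \<subseteq> C n K" for n unfolding B'_def C_def by blast
  then have "c \<le> emeasure N (C n K) + ennreal \<epsilon>" for n
    using K[of n] outer_measure_of_mono[of "B' n K" "C n K" N] C_sets[of n]
    by (metis add_right_mono order_less_imp_le order_trans outer_measure_of_eq)
  then have "c \<le> (INF n. emeasure N (C n K) + ennreal \<epsilon>)" by (intro INF_greatest)
  also have "\<dots> = (INF n. emeasure N (C n K)) + ennreal \<epsilon>"
    by (simp add: INF_ennreal_add_const)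
  finally have "c \<le> emeasure N (\<Inter>n. C n K) + ennreal \<epsilon>" using INF by simp
  moreover have "(\<Inter>n. C n K) \<in> sets N" using C_sets by auto
  moreover have "(\<Inter>n. C n K) \<subseteq> B"
  proof
    fix x assume x: "x \<in> (\<Inter>n. C n K)"
    \<comment> \<open>Membership in every \<open>C n K\<close> only gives bounded partial branches
      of each length; Koenig's lemma joins them into a full branch.\<close>
    have "\<exists>\<sigma>. \<forall>n. x \<in> R \<sigma> n"
    proof (rule koenig_bounded)
      show "\<exists>\<sigma>. (\<forall>i<n. \<sigma> i \<le> K i) \<and> (\<forall>m\<le>n. x \<in> R \<sigma> m)" for n
      proof -
        have "x \<in> C n K" using x by blast
        then show ?thesis unfolding C_def by auto
      qed
    next
      fix n and \<sigma> \<tau> :: "nat \<Rightarrow> nat" assume "\<And>i. i < n \<Longrightarrow> \<sigma> i = \<tau> i" "x \<in> R \<sigma> n"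
      then show "x \<in> R \<tau> n" using souslin_scheme_prefix[OF sch, of n \<sigma> \<tau>] by simp
    qed
    then show "x \<in> B" unfolding B_def by blast
  qed
  ultimately show ?thesis unfolding c_def by blast
qed

text \<open>\<open>B\<close> lies between a measurable hull attaining its outer measure and a
  countable union of inner approximations; finiteness of the measure makes the difference
  null.\<close>

lemma souslin_sets_completion:
  assumes N: "finite_measure N" and "B \<in> souslin_sets (sets N)"
  shows "B \<in> sets (completion N)"
proof -
  interpret finite_measure N by fact
  obtain R where sch: "souslin_scheme (sets N) R" and B: "B = (\<Union>\<sigma>. \<Inter>n. R \<sigma> n)"
    using assms(2) by (rule souslin_setsE)
  have "R \<sigma> n \<subseteq> space N" for \<sigma> n
    using souslin_scheme_sets[OF sch] sets.sets_into_space by blast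
  then have "B \<subseteq> space N" unfolding B by blast
  then obtain C where C: "C \<in> sets N" "B \<subseteq> C" "outer_measure_of N B = emeasure N C"
    using outer_measure_of_attain by metis
  have "\<forall>m. \<exists>A\<in>sets N. A \<subseteq> B \<and> outer_measure_of N B \<le> emeasure N A + ennreal (1 / Suc m)"
    unfolding B by (intro allI souslin_inner_approx[OF N sch]) simp
  then obtain A where A: "\<And>m. A m \<in> sets N" "\<And>m. A m \<subseteq> B"
    and le: "\<And>m. emeasure N C \<le> emeasure N (A m) + ennreal (1 / Suc m)"
    unfolding C(3) by metis
  define A' where "A' = (\<Union>m. A m)"
  have A': "A' \<in> sets N" "A' \<subseteq> B" using A unfolding A'_def by auto
  have "emeasure N C \<le> emeasure N A'"
  proof (rule ennreal_le_epsilon)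
    fix e :: real assume "0 < e"
    then obtain m where m: "1 / Suc m < e" using nat_approx_posE by blast
    have "emeasure N C \<le> emeasure N (A m) + ennreal (1 / Suc m)" by (rule le)
    also have "\<dots> \<le> emeasure N A' + ennreal e"
      using m A' A(1) unfolding A'_def by (intro add_mono emeasure_mono ennreal_leI) auto
    finally show "emeasure N C \<le> emeasure N A' + ennreal e" .
  qed
  moreover have "emeasure N (C - A') = emeasure N C - emeasure N A'"
    using A' C by (intro emeasure_Diff) auto
  ultimately have "emeasure N (C - A') = 0"
    by (simp add: diff_eq_0_iff_ennreal less_top[symmetric])
  then have "B \<in> measure_completion_sets N"
    unfolding measure_completion_sets_def using A' C by blast
  then show ?thesis by (simp add: measure_completion_sets_eq)
qed

subsection \<open>Measurable projection\<close>

lemma sets_Borel_of: "sets (Borel_of T) = sigma_sets (topspace T) {U. openin T U}"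
  and space_Borel_of: "space (Borel_of T) = topspace T"
proof -
  have "{U. openin T U} \<subseteq> Pow (topspace T)" using openin_subset by blast
  then show "sets (Borel_of T) = sigma_sets (topspace T) {U. openin T U}"
    and "space (Borel_of T) = topspace T"
    unfolding Borel_of_def by (simp_all add: sets_measure_of space_measure_of)
qed

lemma measurable_Borel_of:
  assumes "continuous_map P T f"
  shows "f \<in> Borel_of P \<rightarrow>\<^sub>M Borel_of T"
proof (rule measurable_sigma_sets[OF sets_Borel_of])
  show "f \<in> space (Borel_of P) \<rightarrow> topspace T"
    using assms by (auto simp: space_Borel_of continuous_map_def)
next
  fix U assume "U \<in> {U. openin T U}"
  then have "openin P (f -` U \<inter> topspace P)"
    using assms by (auto simp: continuous_map_def vimage_def Int_def conj_commute)
  then show "f -` U \<inter> space (Borel_of P) \<in> sets (Borel_of P)"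
    by (auto simp: space_Borel_of sets_Borel_of)
qed (use openin_subset in blast)

text \<open>Generators for an induction over the product \<sigma>-algebra that only has to start
  from open second factors.\<close>

lemma sets_pair_Borel_of:
  "sets (M \<Otimes>\<^sub>M Borel_of T) =
    sigma_sets (space M \<times> topspace T) {E \<times> U |E U. E \<in> sets M \<and> openin T U}"
proof -
  have "sets (M \<Otimes>\<^sub>M Borel_of T) =
      sets (sigma (space M \<times> space (Borel_of T)) {E \<times> U |E U. E \<in> sets M \<and> U \<in> {U. openin T U}})"
  proof (rule sets_pair_eq[of _ _ "{space M}" _ _ "{topspace T}"])
    show "{U. openin T U} \<subseteq> Pow (space (Borel_of T))"
      using openin_subset unfolding space_Borel_of by blast
  qed (auto simp: space_Borel_of sets_Borel_of sets.sigma_sets_eq sets.space_closed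
      dest: sets.sets_into_space)
  also have "\<dots> = sigma_sets (space M \<times> topspace T) {E \<times> U |E U. E \<in> sets M \<and> openin T U}"
  proof -
    have "{E \<times> U |E U. E \<in> sets M \<and> openin T U} \<subseteq> Pow (space M \<times> topspace T)"
      by (auto dest: sets.sets_into_space openin_subset[THEN subsetD])
    then show ?thesis by (simp add: space_Borel_of sets_measure_of)
  qed
  finally show ?thesis .
qed

text \<open>Second factors are closed, not open, so that Cantor's intersection theorem applies to
  them when projecting.\<close>

definition closed_rectangles :: "'w measure \<Rightarrow> 'p topology \<Rightarrow> ('w \<times> 'p) set set" where
  "closed_rectangles M T = {E \<times> C |E C. E \<in> sets M \<and> closedin T C}"

lemma closed_rectanglesI: "E \<in> sets M \<Longrightarrow> closedin T C \<Longrightarrow> E \<times> C \<in> closed_rectangles M T"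
  unfolding closed_rectangles_def by blast

lemma souslin_closed_rectangles_UN:
  assumes "\<And>m::nat. A m \<in> souslin_sets (closed_rectangles M T)"
  shows "(\<Union>m. A m) \<in> souslin_sets (closed_rectangles M T)"
proof (rule souslin_sets_UN[OF assms])
  show "space M \<times> topspace T \<in> closed_rectangles M T"
    by (intro closed_rectanglesI) auto
next
  fix G assume "G \<in> closed_rectangles M T"
  then obtain E C where "G = E \<times> C" "E \<in> sets M" "closedin T C"
    unfolding closed_rectangles_def by blast
  then show "G \<subseteq> space M \<times> topspace T"
    using sets.sets_into_space[of E M] closedin_subset[of T C] by auto
qed

text \<open>The Souslin sets need not be closed under complement, hence the induction over pairs of
  complementary sets.\<close>

lemma pair_Borel_of_souslin:
  assumes T: "metrizable_space T" and A: "A \<in> sets (M \<Otimes>\<^sub>M Borel_of T)"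
  shows "A \<in> souslin_sets (closed_rectangles M T)"
proof -
  let ?\<Omega> = "space M \<times> topspace T" and ?\<S> = "souslin_sets (closed_rectangles M T)"
  have rect: "E \<times> C \<in> ?\<S>" if "E \<in> sets M" "closedin T C" for E C
    using that by (intro souslin_sets_base closed_rectanglesI)
  have "A \<in> sigma_sets ?\<Omega> {E \<times> U |E U. E \<in> sets M \<and> openin T U}"
    using A unfolding sets_pair_Borel_of .
  then have "A \<in> ?\<S> \<and> ?\<Omega> - A \<in> ?\<S>"
  proof (induction rule: sigma_sets.induct)
    case (Basic a)
    then obtain E U where a: "a = E \<times> U" "E \<in> sets M" "openin T U" by blast
    \<comment> \<open>Open sets of a metrizable space are countable unions of closed sets.\<close>
    obtain C :: "nat \<Rightarrow> _" where C: "\<And>n. closedin T (C n)" "(\<Union>n. C n) = U"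
      using open_imp_fsigma_in[OF T a(3)] unfolding fsigma_in_ascending by blast
    have "a = (\<Union>n. E \<times> C n)" using a C by blast
    moreover have "(\<Union>n. E \<times> C n) \<in> ?\<S>"
      using a C by (intro souslin_closed_rectangles_UN rect) auto
    \<comment> \<open>The two pieces of the complement are written as a sequence, the second
      repeated, to fit closure under countable unions.\<close>
    moreover have "?\<Omega> - a = (\<Union>n::nat. if n = 0 then (space M - E) \<times> topspace T
        else space M \<times> (topspace T - U))"
      using sets.sets_into_space[OF a(2)] unfolding a(1) by (auto split: if_splits intro: exI[of _ 0] exI[of _ 1])
    moreover have "(\<Union>n::nat. if n = 0 then (space M - E) \<times> topspace T
        else space M \<times> (topspace T - U)) \<in> ?\<S>"
    proof (rule souslin_closed_rectangles_UN)
      show "(if n = 0 then (space M - E) \<times> topspace T else space M \<times> (topspace T - U)) \<in> ?\<S>"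
        for n :: nat
        using a by (auto intro!: rect closedin_diff)
    qed
    ultimately show ?case by metis
  next
    case Empty
    then show ?case using rect[of "{}" "{}"] rect[of "space M" "topspace T"] by simp
  next
    case (Compl a)
    have "a \<subseteq> ?\<Omega>"
      using sigma_sets_into_sp[OF _ Compl.hyps] by (auto dest: sets.sets_into_space openin_subset)
    then show ?case using Compl.IH by (simp add: double_diff)
  next
    case (Union a)
    have "(\<Union>i. a i) \<in> ?\<S>" using Union.IH by (intro souslin_closed_rectangles_UN) auto
    moreover have "(\<Inter>i. ?\<Omega> - a i) \<in> ?\<S>" using Union.IH by (intro souslin_sets_INT) auto
    moreover have "?\<Omega> - (\<Union>i. a i) = (\<Inter>i. ?\<Omega> - a i)" by blast
    ultimately show ?case by metis
  qed
  then show ?thesis ..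
qed

lemma (in Metric_space) dense_sequence:
  assumes "separable_space mtopology" "M \<noteq> {}"
  obtains p :: "nat \<Rightarrow> 'a" where "\<And>i. p i \<in> M" "\<And>x r. x \<in> M \<Longrightarrow> 0 < r \<Longrightarrow> \<exists>i. d (p i) x < r"
proof -
  obtain D where D: "countable D" "D \<subseteq> M" "mtopology closure_of D = M"
    using assms(1) unfolding separable_space_def by auto
  have "D \<noteq> {}" using D(3) assms(2) by auto
  then have range: "range (from_nat_into D) = D"
    using D(1) by (rule range_from_nat_into)
  show thesis
  proof (rule that[of "from_nat_into D"])
    show "from_nat_into D i \<in> M" for i using range D(2) by blast
    fix x and r :: real assume "x \<in> M" "0 < r"
    then have "x \<in> mtopology closure_of D" using D(3) by simp
    then obtain y where "y \<in> D" "y \<in> mball x r"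
      using \<open>0 < r\<close> unfolding metric_closure_of by blast
    moreover from range \<open>y \<in> D\<close> obtain i where "from_nat_into D i = y" by (metis rangeE)
    ultimately show "\<exists>i. d (from_nat_into D i) x < r" by (auto simp: commute)
  qed
qed

text \<open>Adding to the branch of a Souslin scheme a branch of small balls around a dense sequence makes
  the second factors shrink, so that by completeness they have a common point as soon as
  all their finite intersections are nonempty.\<close>

lemma (in Metric_space) souslin_projection:
  assumes compl: mcomplete and sep: "separable_space mtopology"
    and A: "A \<in> souslin_sets (closed_rectangles N mtopology)"
  shows "fst ` A \<in> souslin_sets (sets N)"
proof (cases "A = {}")
  case True
  then show ?thesis by (simp add: souslin_sets_base)
next
  case False
  obtain R where sch: "souslin_scheme (closed_rectangles N mtopology) R"
    and A_eq: "A = (\<Union>\<sigma>. \<Inter>n. R \<sigma> n)"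
    using A by (rule souslin_setsE)
  have "\<exists>E C. G = E \<times> C \<and> E \<in> sets N \<and> closedin mtopology C"
    if "G \<in> closed_rectangles N mtopology" for G
    using that unfolding closed_rectangles_def by blast
  then obtain e c where ec: "\<And>G. G \<in> closed_rectangles N mtopology \<Longrightarrow>
      G = e G \<times> c G \<and> e G \<in> sets N \<and> closedin mtopology (c G)"
    by metis
  define E where "E \<sigma> n = e (R \<sigma> n)" for \<sigma> n
  define C where "C \<sigma> n = c (R \<sigma> n)" for \<sigma> n
  have R: "R \<sigma> n = E \<sigma> n \<times> C \<sigma> n" and E: "E \<sigma> n \<in> sets N" and C: "closedin mtopology (C \<sigma> n)" for \<sigma> n
    using ec[OF souslin_scheme_sets[OF sch]] unfolding E_def C_def by auto
  have prefix: "E \<sigma> n = E \<tau> n \<and> C \<sigma> n = C \<tau> n" if "\<And>i. i < n \<Longrightarrow> \<sigma> i = \<tau> i" for \<sigma> \<tau> n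
    using souslin_scheme_prefix[OF sch that] unfolding E_def C_def by simp
  have C_M: "C \<sigma> n \<subseteq> M" for \<sigma> n using closedin_subset[OF C] by simp
  have "M \<noteq> {}" using False C_M unfolding A_eq R by blast
  then obtain p :: "nat \<Rightarrow> 'a" where p: "\<And>i. p i \<in> M" "\<And>x r. x \<in> M \<Longrightarrow> 0 < r \<Longrightarrow> \<exists>i. d (p i) x < r"
    using dense_sequence[OF sep] by metis
  \<comment> \<open>Each entry of \<open>\<rho>\<close> codes a pair: \<open>fs\<close> recovers the
    branch of the given scheme, \<open>sn\<close> the indices of the ball centres.\<close>
  define fs where "fs \<rho> i = fst (prod_decode (\<rho> i))" for \<rho> :: "nat \<Rightarrow> nat" and i :: nat
  define sn where "sn \<rho> i = snd (prod_decode (\<rho> i))" for \<rho> :: "nat \<Rightarrow> nat" and i :: nat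
  \<comment> \<open>The ranges differ because level \<open>n\<close> may read only entries below
    \<open>n\<close>: \<open>C (fs \<rho>) i\<close> reads entries below \<open>i\<close>, whereas
    ball \<open>i\<close> reads entry \<open>i\<close> itself.\<close>
  define D where "D \<rho> n = (\<Inter>i\<in>{..n}. C (fs \<rho>) i) \<inter> (\<Inter>i\<in>{..<n}. mcball (p (sn \<rho> i)) (1 / Suc i))"
    for \<rho> n
  \<comment> \<open>Testing \<open>D \<rho> n\<close> for emptiness eliminates the second coordinate
    and leaves only sets of \<open>N\<close>.\<close>
  define R' where "R' \<rho> n = (if D \<rho> n = {} then {} else E (fs \<rho>) n)" for \<rho> n
  show ?thesis
  proof (rule souslin_setsI[of R'])
    show "R' \<rho> n \<in> sets N" for \<rho> n unfolding R'_def using E by simp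
  next
    fix \<rho> \<rho>' :: "nat \<Rightarrow> nat" and n assume eq: "\<And>i. i < n \<Longrightarrow> \<rho> i = \<rho>' i"
    then have fs: "fs \<rho> i = fs \<rho>' i" and sn: "sn \<rho> i = sn \<rho>' i" if "i < n" for i
      using that unfolding fs_def sn_def by simp_all
    have CE: "E (fs \<rho>) i = E (fs \<rho>') i \<and> C (fs \<rho>) i = C (fs \<rho>') i" if "i \<le> n" for i
      by (rule prefix) (use fs that in simp)
    have "D \<rho> n = D \<rho>' n" unfolding D_def using CE sn by simp
    then show "R' \<rho> n = R' \<rho>' n" unfolding R'_def using CE[of n] by simp
  next
    show "fst ` A = (\<Union>\<rho>. \<Inter>n. R' \<rho> n)"
    proof (intro equalityI subsetI)
      fix \<omega> assume "\<omega> \<in> fst ` A"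
      then obtain x \<sigma> where "\<forall>n. (\<omega>, x) \<in> R \<sigma> n" unfolding A_eq by auto
      then have \<omega>: "\<And>n. \<omega> \<in> E \<sigma> n" and x: "\<And>n. x \<in> C \<sigma> n" unfolding R by auto
      have "x \<in> M" using x C_M by blast
      then have "\<forall>i. \<exists>j. d (p j) x < 1 / Suc i" using p(2) by simp
      then obtain \<tau> where \<tau>: "\<And>i. d (p (\<tau> i)) x < 1 / Suc i" by metis
      define \<rho> where "\<rho> i = prod_encode (\<sigma> i, \<tau> i)" for i
      have fs: "fs \<rho> = \<sigma>" and sn: "sn \<rho> = \<tau>" unfolding fs_def sn_def \<rho>_def by auto
      have "x \<in> D \<rho> n" for n
        unfolding D_def fs sn using x \<open>x \<in> M\<close> p(1) \<tau> by (auto simp: less_imp_le)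
      then have "\<omega> \<in> R' \<rho> n" for n unfolding R'_def fs using \<omega> by auto
      then show "\<omega> \<in> (\<Union>\<rho>. \<Inter>n. R' \<rho> n)" by blast
    next
      fix \<omega> assume "\<omega> \<in> (\<Union>\<rho>. \<Inter>n. R' \<rho> n)"
      then obtain \<rho> where "\<And>n. \<omega> \<in> R' \<rho> n" by blast
      then have ne: "D \<rho> n \<noteq> {}" and \<omega>: "\<omega> \<in> E (fs \<rho>) n" for n
        unfolding R'_def by (metis empty_iff)+
      have "closedin mtopology (D \<rho> n)" for n
      proof -
        have "closedin mtopology (\<Inter>i\<in>{..n}. C (fs \<rho>) i)" using C by (intro closedin_INT) auto
        \<comment> \<open>For \<open>n = 0\<close> the intersection of no balls is
          \<open>UNIV\<close>, which need not be closed in the space.\<close>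
        moreover have "closedin mtopology (\<Inter>i\<in>{..<n}. mcball (p (sn \<rho> i)) (1 / Suc i))" if "n \<noteq> 0"
          using that by (intro closedin_INT) auto
        ultimately show ?thesis unfolding D_def by (cases "n = 0") (auto intro: closedin_Int)
      qed
      moreover have "decseq (D \<rho>)"
        by (rule decseq_SucI) (auto simp: D_def)
      moreover have "\<exists>n a. D \<rho> n \<subseteq> mcball a r" if "0 < r" for r
      proof -
        obtain n where n: "1 / Suc n < r" using nat_approx_posE[OF \<open>0 < r\<close>] by blast
        have "D \<rho> (Suc n) \<subseteq> mcball (p (sn \<rho> n)) (1 / Suc n)" unfolding D_def by blast
        also have "\<dots> \<subseteq> mcball (p (sn \<rho> n)) r" using n by (intro mcball_subset_concentric) simp
        finally show ?thesis by blast
      qed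
      \<comment> \<open>Cantor's intersection theorem: nonempty closed decreasing sets inside
        arbitrarily small balls.\<close>
      ultimately have "\<Inter> (range (D \<rho>)) \<noteq> {}"
        using compl ne unfolding mcomplete_nest by blast
      then obtain x where x: "\<And>n. x \<in> D \<rho> n" by blast
      then have "x \<in> C (fs \<rho>) n" for n unfolding D_def by blast
      then have "(\<omega>, x) \<in> A" unfolding A_eq R using \<omega> by blast
      then show "\<omega> \<in> fst ` A" by force
    qed
  qed
qed

text \<open>Pulling \<open>A\<close> back along \<open>f\<close> in the second coordinate moves the
  problem to the Polish space \<open>P\<close>; surjectivity of \<open>f\<close> leaves the
  projection to the first coordinate unchanged.\<close>

lemma projection_measurable_completion:
  fixes S :: "'s metric"
  assumes S: "Souslin_space TYPE('p) S" and A: "A \<in> sets (M \<Otimes>\<^sub>M Borel_of (mtopology_of S))"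
    and N: "finite_measure N" "sets N = sets M"
  shows "fst ` A \<in> sets (completion N)"
proof -
  obtain P :: "'p topology" and f where P: "completely_metrizable_space P" "separable_space P"
    and f: "continuous_map P (mtopology_of S) f" "f ` topspace P = mspace S"
    using S unfolding Souslin_space_def Polish_space_def by blast
  obtain Y d where Y: "Metric_space Y d" "Metric_space.mcomplete Y d" "P = Metric_space.mtopology Y d"
    using P(1) unfolding completely_metrizable_space_def by blast
  interpret Y: Metric_space Y d by fact
  define g where "g = (\<lambda>(\<omega>, y). (\<omega> :: 'a, f y))"
  have [measurable]: "f \<in> Borel_of P \<rightarrow>\<^sub>M Borel_of (mtopology_of S)"
    by (rule measurable_Borel_of[OF f(1)])
  have "g \<in> M \<Otimes>\<^sub>M Borel_of P \<rightarrow>\<^sub>M M \<Otimes>\<^sub>M Borel_of (mtopology_of S)"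
    unfolding g_def by measurable
  then have "g -` A \<inter> space (M \<Otimes>\<^sub>M Borel_of P) \<in> sets (M \<Otimes>\<^sub>M Borel_of P)"
    using A by (rule measurable_sets)
  then have "g -` A \<inter> space (M \<Otimes>\<^sub>M Borel_of P) \<in> souslin_sets (closed_rectangles M P)"
    by (rule pair_Borel_of_souslin[OF completely_metrizable_imp_metrizable_space[OF P(1)]])
  then have "fst ` (g -` A \<inter> space (M \<Otimes>\<^sub>M Borel_of P)) \<in> souslin_sets (sets M)"
    using P(2) unfolding Y(3) by (intro Y.souslin_projection[OF Y(2)])
  moreover have "fst ` (g -` A \<inter> space (M \<Otimes>\<^sub>M Borel_of P)) = fst ` A"
  proof (intro equalityI subsetI)
    fix \<omega> assume "\<omega> \<in> fst ` A"
    then obtain s where s: "(\<omega>, s) \<in> A" by auto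
    then have "\<omega> \<in> space M" "s \<in> mspace S"
      using sets.sets_into_space[OF A] by (auto simp: space_pair_measure space_Borel_of)
    then obtain y where "y \<in> topspace P" "s = f y" using f(2) by blast
    with s \<open>\<omega> \<in> space M\<close> have "(\<omega>, y) \<in> g -` A \<inter> space (M \<Otimes>\<^sub>M Borel_of P)"
      by (simp add: g_def space_pair_measure space_Borel_of)
    then show "\<omega> \<in> fst ` (g -` A \<inter> space (M \<Otimes>\<^sub>M Borel_of P))" by force
  next
    fix \<omega> assume "\<omega> \<in> fst ` (g -` A \<inter> space (M \<Otimes>\<^sub>M Borel_of P))"
    then show "\<omega> \<in> fst ` A" unfolding g_def by force
  qed
  ultimately show ?thesis
    using souslin_sets_completion[OF N(1)] N(2) by simp
qed

subsection \<open>Measurability of intersections\<close>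

text \<open>For countable \<open>I\<close> the sets to be checked are countable unions of
  complements of preimages of open sets.\<close>

lemma multi_Inter_countable_closed_measurable:
  assumes sep: "C_separating X \<U>" "countable \<U>" "t1_space X" and I: "countable I"
    and F: "\<And>i. i \<in> I \<Longrightarrow> closed_measurable M X (F i)"
    and K: "\<And>i. i \<in> I \<Longrightarrow> compact_valued (space M) X (F i)"
  shows "closed_measurable M X (multi_Inter X I F)"
proof (cases "I = {}")
  case True
  then show ?thesis by (simp add: multi_Inter_empty_closed_measurable)
next
  case False
  then obtain i0 where i0: "i0 \<in> I" by blast
  show ?thesis
  proof (rule multi_Inter_closed_measurable[OF sep i0])
    show "compact_valued (space M) X (F i)" if "i \<in> I" for i using that by (rule K)
    show "closed_measurable M X (F i0)" using i0 by (rule F)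
  next
    fix U assume "U \<in> \<U>"
    then have "openin X U" using sep(1) unfolding C_separating_def by blast
    then have "multi_preimage (space M) (F i) U \<in> sets M" if "i \<in> I" for i
      using closed_measurable_open[OF sep F[OF that]] by simp
    then have "(\<Union>i\<in>I. space M - multi_preimage (space M) (F i) U) \<in> sets M"
      using I by (intro sets.countable_UN') auto
    moreover have "{\<omega> \<in> space M. \<exists>i\<in>I. F i \<omega> \<inter> U = {}}
        = (\<Union>i\<in>I. space M - multi_preimage (space M) (F i) U)"
      unfolding multi_preimage_def by auto
    ultimately show "{\<omega> \<in> space M. \<exists>i\<in>I. F i \<omega> \<inter> U = {}} \<in> sets M" by simp
  qed
qed

text \<open>With one finite measure \<open>N\<close> fixed, the core lemma is applied over
  \<open>completion N\<close>, where projections from the product with \<open>S\<close> are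
  measurable.\<close>

lemma multi_Inter_souslin_closed_measurable:
  fixes S :: "'s metric"
  assumes sep: "C_separating X \<U>" "countable \<U>" "t1_space X"
    and S: "Souslin_space TYPE('p) S" and F: "closed_measurable_family M S X F"
    and K: "\<And>s. s \<in> mspace S \<Longrightarrow> compact_valued (space M) X (F s)"
    and N: "finite_measure N" "sets N = sets M"
  shows "closed_measurable (completion N) X (multi_Inter X (mspace S) F)"
proof (cases "mspace S = {}")
  case True
  then show ?thesis by (simp add: multi_Inter_empty_closed_measurable)
next
  case False
  then obtain s0 where s0: "s0 \<in> mspace S" by blast
  let ?B = "Borel_of (mtopology_of S)"
  let ?G = "\<lambda>(\<omega>, s). F s \<omega>"
  have spN: "space (completion N) = space M" using sets_eq_imp_space_eq[OF N(2)] by simp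
  have sp: "space (M \<Otimes>\<^sub>M ?B) = space M \<times> mspace S"
    by (simp add: space_pair_measure space_Borel_of)
  have G: "closed_measurable (M \<Otimes>\<^sub>M ?B) X ?G"
    using F unfolding closed_measurable_family_def .
  show ?thesis
  proof (rule multi_Inter_closed_measurable[OF sep s0])
    show "compact_valued (space (completion N)) X (F s)" if "s \<in> mspace S" for s
      using K[OF that] unfolding spN .
    show "closed_measurable (completion N) X (F s0)"
      unfolding closed_measurable_def
    proof (intro allI impI)
      fix C assume "closedin X C"
      then have "multi_preimage (space (M \<Otimes>\<^sub>M ?B)) ?G C \<in> sets (M \<Otimes>\<^sub>M ?B)"
        using G unfolding closed_measurable_def by blast
      \<comment> \<open>The single multifunction \<open>F s0\<close> is measurable because sections
        of product-measurable sets are.\<close>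
      then have "(\<lambda>\<omega>. (\<omega>, s0)) -` multi_preimage (space (M \<Otimes>\<^sub>M ?B)) ?G C \<in> sets M"
        by (rule sets_Pair2)
      moreover have "(\<lambda>\<omega>. (\<omega>, s0)) -` multi_preimage (space (M \<Otimes>\<^sub>M ?B)) ?G C
          = multi_preimage (space M) (F s0) C"
        using s0 unfolding multi_preimage_def sp by auto
      ultimately show "multi_preimage (space (completion N)) (F s0) C \<in> sets (completion N)"
        using N(2) spN by (metis sets_completionI_sets)
    qed
  next
    fix U assume "U \<in> \<U>"
    then have "openin X U" using sep(1) unfolding C_separating_def by blast
    then have "multi_preimage (space (M \<Otimes>\<^sub>M ?B)) ?G U \<in> sets (M \<Otimes>\<^sub>M ?B)"
      by (rule closed_measurable_open[OF sep G])
    \<comment> \<open>The projected set consists of the pairs \<open>(\<omega>, s)\<close> for which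
      \<open>F s \<omega>\<close> misses \<open>U\<close>.\<close>
    then have "fst ` (space (M \<Otimes>\<^sub>M ?B) - multi_preimage (space (M \<Otimes>\<^sub>M ?B)) ?G U) \<in> sets (completion N)"
      by (intro projection_measurable_completion[OF S _ N]) auto
    moreover have "fst ` (space (M \<Otimes>\<^sub>M ?B) - multi_preimage (space (M \<Otimes>\<^sub>M ?B)) ?G U)
        = {\<omega> \<in> space (completion N). \<exists>s\<in>mspace S. F s \<omega> \<inter> U = {}}"
      unfolding multi_preimage_def sp spN by force
    ultimately show "{\<omega> \<in> space (completion N). \<exists>s\<in>mspace S. F s \<omega> \<inter> U = {}} \<in> sets (completion N)"
      by simp
  qed
qed

theorem theorem3p6:
  fixes M :: "'w measure" and X :: "'x topology"
  assumes "countably_C_separated X" and "t1_space X"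
  shows
    "(\<forall>(I :: 'i set) (F :: 'i \<Rightarrow> 'w \<Rightarrow> 'x set).
        countable I \<and>
        (\<forall>i\<in>I. closed_measurable M X (F i) \<and> compact_valued (space M) X (F i)) \<longrightarrow>
        closed_measurable M X (multi_Inter X I F)) \<and>
     (\<forall>(S :: 's metric) (F :: 's \<Rightarrow> 'w \<Rightarrow> 'x set).
        Souslin_space TYPE('p) S \<and>
        closed_measurable_family M S X F \<and>
        (\<forall>s\<in>mspace S. compact_valued (space M) X (F s)) \<longrightarrow>
        universally_closed_measurable M X (multi_Inter X (mspace S) F))"
proof -
  obtain \<U> where \<U>: "countable \<U>" "C_separating X \<U>"
    using assms(1) unfolding countably_C_separated_def by blast
  show ?thesis
  proof (intro conjI allI impI; elim conjE)
    fix I :: "'i set" and F :: "'i \<Rightarrow> 'w \<Rightarrow> 'x set"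
    assume "countable I"
      and "\<forall>i\<in>I. closed_measurable M X (F i) \<and> compact_valued (space M) X (F i)"
    then show "closed_measurable M X (multi_Inter X I F)"
      by (intro multi_Inter_countable_closed_measurable[OF \<U>(2,1) assms(2)]) auto
  next
    fix S :: "'s metric" and F :: "'s \<Rightarrow> 'w \<Rightarrow> 'x set"
    assume S: "Souslin_space TYPE('p) S" and F: "closed_measurable_family M S X F"
      and K: "\<forall>s\<in>mspace S. compact_valued (space M) X (F s)"
    show "universally_closed_measurable M X (multi_Inter X (mspace S) F)"
      unfolding universally_closed_measurable_def universally_measurable_def
    proof (intro allI impI; elim conjE)
      fix C and N :: "'w measure"
      assume C: "closedin X C" and N: "finite_measure N" "sets N = sets M"
      have "closed_measurable (completion N) X (multi_Inter X (mspace S) F)"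
        by (rule multi_Inter_souslin_closed_measurable[OF \<U>(2,1) assms(2) S F _ N]) (use K in blast)
      then have "multi_preimage (space (completion N)) (multi_Inter X (mspace S) F) C \<in> sets (completion N)"
        using C unfolding closed_measurable_def by blast
      then show "multi_preimage (space M) (multi_Inter X (mspace S) F) C \<in> measure_completion_sets N"
        using sets_eq_imp_space_eq[OF N(2)] by (simp add: measure_completion_sets_eq)
    qed
  qed
qed

end
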